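(* Let $n$ be a positive even integer with $n\equiv2\pmod3$ satisfying one of: (a) $n\ge20$, $n\equiv0\pmod5$; (b) $n\ge206$, $n\equiv1\pmod5$; (c) $n\ge115$, $n\equiv2\pmod5$; (d) $n\ge163$, $n\equiv3\pmod5$; (e) $n\ge235$, $n\equiv4\pmod5$. Let $H$ be any abelian group of order $n^2+n+1$. Then there are no inverse-closed subsets $T_0,T_1\subseteq H$ with $e\in T_0$ satisfying $T_0T_1=H-e$ and $T_0^2+T_1^2=2H-T_0^{(2)}-T_1^{(2)}+2ne$ in $\mathbb{Z}[H]$.
   Context: $H$ is written multiplicatively with identity $e$; $\mathbb{Z}[H]$ is the integral group ring, a subset $D\subseteq H$ is identified with $\sum_{g\in D}g$, and $H$ also denotes $\sum_{h\in H}h$. For $A=\sum a_gg$ and $t\in\mathbb{Z}$, $A^{(t)}=\sum a_gg^t$. Inverse-closed means $T^{(-1)}=T$. *)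

theory Defs
  imports "HOL-Library.Poly_Mapping" "HOL-Library.Cardinality"
begin

text \<open>
  Abelian groups are written additively (class \<^class>\<open>ab_group_add\<close>): the group operation
  $gh$ becomes \<open>g + h\<close>, the identity $e$ becomes \<open>0\<close>, and the power $g^t$ becomes the integer
  multiple \<open>int_multiple t g\<close>.  The integral group ring is the commutative ring of finitely
  supported functions \<open>'h \<Rightarrow>\<^sub>0 int\<close>, whose library multiplication is convolution along \<open>+\<close>;
  the group element \<open>g\<close> is \<open>Poly_Mapping.single g 1\<close>.
\<close>

type_synonym 'h group_ring = "'h \<Rightarrow>\<^sub>0 int"

definition group_elem :: "'h::ab_group_add \<Rightarrow> 'h group_ring" where
  "group_elem g = Poly_Mapping.single g 1"

definition set_elem :: "'h::{finite, ab_group_add} set \<Rightarrow> 'h group_ring" where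
  "set_elem D = (\<Sum>g\<in>D. group_elem g)"

definition int_multiple :: "int \<Rightarrow> 'h::ab_group_add \<Rightarrow> 'h" where
  "int_multiple t g = (if t \<ge> 0 then (\<Sum>i<nat t. g) else - (\<Sum>i<nat (- t). g))"

text \<open>
  $A^{(t)} = \sum a_g g^t$.  Coefficients add up where $g \mapsto g^t$ is not injective,
  so this is not a mere relabelling of the support.
\<close>

definition adams_power :: "'h::{finite, ab_group_add} group_ring \<Rightarrow> int \<Rightarrow> 'h group_ring" where
  "adams_power A t =
     (\<Sum>g\<in>UNIV. Poly_Mapping.single (int_multiple t g) (Poly_Mapping.lookup A g))"

definition inverse_closed :: "'h::{finite, ab_group_add} set \<Rightarrow> bool" where
  "inverse_closed T \<longleftrightarrow> adams_power (set_elem T) (-1) = set_elem T"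

end

theory Submission
  imports Defs "HOL-Number_Theory.Cong"
begin

text \<open>
  Write $A = T_0$, $B = T_1$, $P = T_0^{(2)} + T_1^{(2)}$ and $Q = P^{(2)}$.  The hypotheses force
  $|A| = n + 1$ and $|B| = n$, and they express $AP$, $BP$ and $AQ$ through $A^3$, $B^3$ and $A^5$.
  As $A^p \equiv A^{(p)}$ modulo a prime $p$, the coefficients $a, b, q$ of $AP, BP, AQ$ at any
  group element satisfy congruences modulo 3 and 5 that depend only on its membership in the
  sets $T_0, T_1, T_0^{(3)}, T_1^{(3)}, T_0^{(5)}$, all of size $O(n)$.  For most elements
  $a \equiv b \equiv 1$ modulo 3, and the residue of $q$ modulo 5 is a function of $a$ and $b$.
  On the other hand the sums of $a, b, q$ over the group are known, and those of $a^2, b^2, ab$ are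
  bounded above, since $P^2 = 4H + 2n - 2 - Q$.  For each residue of $n$ modulo 5 a suitable
  linear combination of $q, a, b, a^2, b^2, ab$ is pointwise too large for these sums.
\<close>

section \<open>The integral group ring\<close>

abbreviation coeff :: "'h::{finite, ab_group_add} group_ring \<Rightarrow> 'h \<Rightarrow> int" where
  "coeff \<equiv> Poly_Mapping.lookup"

lemma finite_Sum_any: "Sum_any (f :: 'h::finite \<Rightarrow> 'a::comm_monoid_add) = (\<Sum>x\<in>UNIV. f x)"
  by (simp add: Sum_any.expand_superset)

lemma lookup_mult_convolution:
  fixes x y :: "'h::{finite, ab_group_add} group_ring"
  shows "coeff (x * y) k = (\<Sum>l\<in>UNIV. coeff x l * coeff y (k - l))"
proof -
  have "(\<Sum>q\<in>UNIV. coeff y q when k = l + q) = coeff y (k - l)" for l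
  proof -
    have "(k = l + q) = (k - l = q)" for q by (auto simp: algebra_simps)
    then show ?thesis by (simp add: when_def)
  qed
  then show ?thesis by (simp add: lookup_mult finite_Sum_any)
qed

lemma lookup_of_int_mult [simp]:
  fixes x :: "'h::{finite, ab_group_add} group_ring"
  shows "coeff (of_int c * x) g = c * coeff x g"
proof -
  have "(of_int c :: 'h group_ring) = Poly_Mapping.single 0 c"
    using single_of_int[of c, where ?'b = int, symmetric] by simp
  moreover have "coeff (Poly_Mapping.single 0 c * x) g
      = (\<Sum>l\<in>{0}. coeff (Poly_Mapping.single 0 c) l * coeff x (g - l))"
    unfolding lookup_mult_convolution
    by (rule sum.mono_neutral_right) (auto simp: lookup_single when_def)
  ultimately show ?thesis by simp
qed

lemma lookup_of_nat_mult [simp]: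
  fixes x :: "'h::{finite, ab_group_add} group_ring"
  shows "coeff (of_nat c * x) g = int c * coeff x g"
  using lookup_of_int_mult[of "int c" x g] by simp

lemma lookup_group_elem: "coeff (group_elem g) h = of_bool (g = h)"
  by (simp add: group_elem_def lookup_single when_def)

lemma lookup_set_elem: "coeff (set_elem D) g = of_bool (g \<in> D)"
  by (simp add: set_elem_def lookup_sum lookup_group_elem of_bool_def sum.If_cases Int_commute)
     
lemma group_elem_0: "group_elem 0 = 1"
  by (simp add: group_elem_def)

lemma group_elem_add: "group_elem (g + h) = group_elem g * group_elem h"
  by (simp add: group_elem_def mult_single)

lemma group_ring_expansion:
  fixes x :: "'h::{finite, ab_group_add} group_ring"
  shows "x = (\<Sum>g\<in>UNIV. of_int (coeff x g) * group_elem g)"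
  by (rule poly_mapping_eqI) (simp add: lookup_sum lookup_group_elem of_bool_def if_distrib sum.delta cong: if_cong)

definition augmentation :: "'h::{finite, ab_group_add} group_ring \<Rightarrow> int" where
  "augmentation x = (\<Sum>g\<in>UNIV. coeff x g)"

lemma augmentation_add: "augmentation (x + y) = augmentation x + augmentation y"
  by (simp add: augmentation_def lookup_add sum.distrib)

lemma augmentation_diff: "augmentation (x - y) = augmentation x - augmentation y"
  by (simp add: augmentation_def lookup_minus sum_subtractf)

lemma augmentation_of_int_mult: "augmentation (of_int c * x) = c * augmentation x"
  by (simp add: augmentation_def sum_distrib_left)

lemma sum_UNIV_diff: "(\<Sum>g\<in>UNIV. f (k - g)) = (\<Sum>g\<in>UNIV. f (g::'h::{finite, ab_group_add}))"
  by (rule sum.reindex_bij_witness[of _ "\<lambda>g. k - g" "\<lambda>g. k - g"]) auto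

lemma augmentation_mult: "augmentation (x * y) = augmentation x * augmentation y"
proof -
  have "augmentation (x * y) = (\<Sum>l\<in>UNIV. \<Sum>k\<in>UNIV. coeff x l * coeff y (k - l))"
    unfolding augmentation_def lookup_mult_convolution by (rule sum.swap)
  also have "\<dots> = (\<Sum>l\<in>UNIV. coeff x l * augmentation y)"
  proof (rule sum.cong[OF refl])
    fix l
    have "(\<Sum>k\<in>UNIV. coeff y (k - l)) = augmentation y"
      unfolding augmentation_def
      by (rule sum.reindex_bij_witness[of _ "\<lambda>g. g + l" "\<lambda>g. g - l"]) auto
    then show "(\<Sum>k\<in>UNIV. coeff x l * coeff y (k - l)) = coeff x l * augmentation y"
      by (simp flip: sum_distrib_left)
  qed
  finally show ?thesis by (simp add: augmentation_def sum_distrib_right)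
qed

lemma augmentation_set_elem: "augmentation (set_elem D) = int (card D)"
  by (simp add: augmentation_def lookup_set_elem of_bool_def sum.If_cases)

lemma augmentation_group_elem: "augmentation (group_elem g) = 1"
  by (simp add: augmentation_def lookup_group_elem of_bool_def)

text \<open>Each coefficient of the product runs exactly once through all coefficients of
  \<open>x\<close>. Products with \<open>H\<close> thereby become scalar multiples of
  \<open>H\<close>.\<close>

lemma set_elem_UNIV_mult: "set_elem UNIV * x = of_int (augmentation x) * set_elem UNIV"
proof (rule poly_mapping_eqI)
  fix k
  have "coeff (set_elem UNIV * x) k = augmentation x"
    by (simp add: lookup_mult_convolution lookup_set_elem augmentation_def sum_UNIV_diff)
  then show "coeff (set_elem UNIV * x) k = coeff (of_int (augmentation x) * set_elem UNIV) k"
    by (simp add: lookup_set_elem)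
qed

section \<open>Multiples in a finite abelian group\<close>

lemma int_multiple_of_nat: "int_multiple (int k) g = (\<Sum>i<k. g)"
  by (simp add: int_multiple_def)

lemma int_multiple_add: "int_multiple t (g + h) = int_multiple t g + int_multiple t h"
  by (simp add: int_multiple_def sum.distrib)

lemma int_multiple_minus: "int_multiple t (- g) = - int_multiple t g"
  by (simp add: int_multiple_def sum_negf)

lemma int_multiple_0 [simp]: "int_multiple t 0 = 0"
  by (simp add: int_multiple_def)

lemma int_multiple_minus_1 [simp]: "int_multiple (- 1) g = - g"
  by (simp add: int_multiple_def)

lemma int_multiple_mult_nat:
  "int_multiple (int (k * l)) g = int_multiple (int k) (int_multiple (int l) g)"
proof (induction k)
  case (Suc k)
  have "(\<Sum>i<l + m. g) = (\<Sum>i<l. g) + (\<Sum>i<m. g)" for m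
    by (induction m) (simp_all add: add.assoc)
  from this[of "k * l"] Suc show ?case
    unfolding int_multiple_of_nat by (simp add: add.commute)
qed (simp add: int_multiple_def)

text \<open>Translation by \<open>g\<close> permutes the group, so the sum of all elements does not
  change when \<open>g\<close> is added once for every element.\<close>

lemma int_multiple_card:
  fixes g :: "'h::{finite, ab_group_add}"
  shows "int_multiple (int CARD('h)) g = 0"
proof -
  have "(\<Sum>x\<in>UNIV. x) = (\<Sum>x\<in>UNIV. x + g)"
    by (rule sum.reindex_bij_witness[of _ "\<lambda>x. x + g" "\<lambda>x. x - g"]) auto
  also have "\<dots> = (\<Sum>x\<in>UNIV. x) + (\<Sum>x\<in>(UNIV::'h set). g)"
    by (simp add: sum.distrib)
  also have "(\<Sum>x\<in>(UNIV::'h set). g) = (\<Sum>i<CARD('h). g)"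
  proof -
    obtain f :: "nat \<Rightarrow> 'h" where "bij_betw f {..<CARD('h)} UNIV"
      using ex_bij_betw_nat_finite[of "UNIV :: 'h set"] by (auto simp: atLeast0LessThan)
    then show ?thesis by (rule sum.reindex_bij_betw[symmetric])
  qed
  finally show ?thesis by (simp add: int_multiple_of_nat)
qed

text \<open>Bezout provides \<open>l\<close> with \<open>l * k\<close> congruent to 1 modulo the
  group order; multiplication by \<open>l\<close> is then a left inverse.\<close>

lemma inj_int_multiple:
  assumes "k > 0" and "coprime k CARD('h::{finite, ab_group_add})"
  shows "inj (int_multiple (int k) :: 'h \<Rightarrow> 'h)"
proof -
  obtain l m where "k * l = CARD('h) * m + gcd k CARD('h)"
    using bezout_nat[of k "CARD('h)"] assms(1) by auto
  then have lm: "l * k = Suc (m * CARD('h))"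
    using assms(2) by (simp add: mult.commute)
  have "int_multiple (int l) (int_multiple (int k) g) = g" for g :: 'h
  proof -
    have "int_multiple (int l) (int_multiple (int k) g) = int_multiple (int (Suc (m * CARD('h)))) g"
      by (simp only: flip: lm int_multiple_mult_nat)
    also have "\<dots> = int_multiple (int (m * CARD('h))) g + g"
      unfolding int_multiple_of_nat by simp
    also have "\<dots> = g"
      by (simp only: int_multiple_mult_nat int_multiple_card) simp
    finally show ?thesis .
  qed
  then show ?thesis by (metis injI)
qed

section \<open>The power operation as a ring endomorphism\<close>

lemma adams_power_altdef:
  "adams_power x t = (\<Sum>g\<in>UNIV. of_int (coeff x g) * group_elem (int_multiple t g))"
proof -
  have "Poly_Mapping.single h c = of_int c * group_elem h" for h :: 'a and c
    by (rule poly_mapping_eqI) (simp add: lookup_single lookup_group_elem when_def)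
  then show ?thesis by (simp add: adams_power_def)
qed

lemma adams_power_add: "adams_power (x + y) t = adams_power x t + adams_power y t"
  by (simp add: adams_power_altdef lookup_add distrib_right sum.distrib)

lemma adams_power_diff: "adams_power (x - y) t = adams_power x t - adams_power y t"
  by (simp add: adams_power_altdef lookup_minus left_diff_distrib sum_subtractf)

lemma adams_power_of_int_mult: "adams_power (of_int c * x) t = of_int c * adams_power x t"
  by (simp add: adams_power_altdef sum_distrib_left mult.assoc)

lemma adams_power_sum: "adams_power (sum f D) t = (\<Sum>d\<in>D. adams_power (f d) t)"
  by (induction D rule: infinite_finite_induct) (simp_all add: adams_power_add, simp_all add: adams_power_altdef)

lemma adams_power_group_elem: "adams_power (group_elem g) t = group_elem (int_multiple t g)"
proof -
  have "adams_power (group_elem g) t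
      = (\<Sum>h\<in>{g}. of_int (coeff (group_elem g) h) * group_elem (int_multiple t h))"
    unfolding adams_power_altdef by (rule sum.mono_neutral_right) (auto simp: lookup_group_elem)
  then show ?thesis by (simp add: lookup_group_elem)
qed

text \<open>Expanding both factors in the basis of group elements reduces this to the additivity of
  \<open>int_multiple t\<close>.\<close>

lemma adams_power_mult: "adams_power (x * y) t = adams_power x t * adams_power y t"
proof -
  have "x * y = (\<Sum>g\<in>UNIV. of_int (coeff x g) * group_elem g) *
      (\<Sum>h\<in>UNIV. of_int (coeff y h) * group_elem h)"
    by (simp flip: group_ring_expansion)
  also have "\<dots> = (\<Sum>g\<in>UNIV. \<Sum>h\<in>UNIV. of_int (coeff x g * coeff y h) * group_elem (g + h))"
    by (simp add: sum_product group_elem_add mult_ac)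
  finally have "adams_power (x * y) t
      = (\<Sum>g\<in>UNIV. \<Sum>h\<in>UNIV. adams_power (of_int (coeff x g * coeff y h) * group_elem (g + h)) t)"
    by (simp only: adams_power_sum)
  also have "\<dots> = (\<Sum>g\<in>UNIV. \<Sum>h\<in>UNIV. (of_int (coeff x g) * group_elem (int_multiple t g)) * (of_int (coeff y h) * group_elem (int_multiple t h)))"
    unfolding adams_power_of_int_mult adams_power_group_elem int_multiple_add
    by (simp add: group_elem_add mult_ac)
  finally show ?thesis by (simp add: adams_power_altdef sum_product)
qed

lemma lookup_adams_power_nonneg:
  assumes "\<And>g. coeff x g \<ge> 0"
  shows "coeff (adams_power x t) h \<ge> 0"
  by (simp add: adams_power_altdef lookup_sum lookup_group_elem assms sum_nonneg)

lemma augmentation_sum: "augmentation (sum f D) = (\<Sum>d\<in>D. augmentation (f d))"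
  by (induction D rule: infinite_finite_induct) (simp_all add: augmentation_add, simp_all add: augmentation_def)

lemma augmentation_adams_power: "augmentation (adams_power x t) = augmentation x"
  by (simp add: adams_power_altdef augmentation_sum augmentation_of_int_mult augmentation_group_elem)
     (simp add: augmentation_def)

lemma adams_power_set_elem: "adams_power (set_elem D) t = (\<Sum>g\<in>D. group_elem (int_multiple t g))"
  by (simp add: set_elem_def adams_power_sum adams_power_group_elem)

text \<open>Injectivity keeps coefficients from adding up, so the result is again the 0/1 indicator
  of a set.\<close>

lemma adams_power_set_elem_inj:
  "inj (int_multiple t :: 'h \<Rightarrow> 'h) \<Longrightarrow>
   adams_power (set_elem D) t = set_elem (int_multiple t ` D :: 'h::{finite, ab_group_add} set)"
  unfolding adams_power_set_elem by (simp add: set_elem_def sum.reindex inj_on_subset)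

section \<open>Powers modulo a prime\<close>

text \<open>The inner binomial coefficients are multiples of \<open>p\<close>. Divisibility in an
  arbitrary commutative ring lets this apply to the integral group ring without passing to a
  quotient.\<close>

lemma prime_dvd_power_add_diff:
  fixes x y :: "'a::comm_ring_1"
  assumes "prime p"
  shows "of_nat p dvd (x + y) ^ p - (x ^ p + y ^ p)"
proof -
  have p: "p > 1" using assms prime_gt_1_nat by blast
  have "(x + y) ^ p = (\<Sum>k\<in>{0,p} \<union> {0<..<p}. of_nat (p choose k) * x ^ k * y ^ (p - k))"
    unfolding binomial_ring using p by (intro sum.cong) auto
  also have "\<dots> = (x ^ p + y ^ p) + (\<Sum>k\<in>{0<..<p}. of_nat (p choose k) * x ^ k * y ^ (p - k))"
    using p by (subst sum.union_disjoint) auto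
  finally have "(x + y) ^ p - (x ^ p + y ^ p) = (\<Sum>k\<in>{0<..<p}. of_nat (p choose k) * x ^ k * y ^ (p - k))"
    by simp
  also have "of_nat p dvd \<dots>"
  proof (intro dvd_sum dvd_mult2)
    fix k assume "k \<in> {0<..<p}"
    then have "p dvd (p choose k)" using assms by (intro dvd_choose_prime) auto
    then show "(of_nat p :: 'a) dvd of_nat (p choose k)" by (auto elim!: dvdE)
  qed
  finally show ?thesis .
qed

lemma prime_dvd_power_sum_diff:
  fixes f :: "'b \<Rightarrow> 'a::comm_ring_1"
  assumes "prime p"
  shows "of_nat p dvd (\<Sum>d\<in>D. f d) ^ p - (\<Sum>d\<in>D. f d ^ p)"
proof (induction D rule: infinite_finite_induct)
  case (insert d D)
  have "(f d + sum f D) ^ p - (f d ^ p + (\<Sum>d\<in>D. f d ^ p)) =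
    ((f d + sum f D) ^ p - (f d ^ p + sum f D ^ p)) + (sum f D ^ p - (\<Sum>d\<in>D. f d ^ p))"
    by simp
  also have "of_nat p dvd \<dots>"
    using insert by (intro dvd_add prime_dvd_power_add_diff assms) auto
  finally show ?case using insert by simp
qed (use prime_gt_0_nat[OF assms] in \<open>simp_all add: zero_power\<close>)

lemma group_elem_power: "group_elem g ^ k = group_elem (int_multiple (int k) g)"
proof -
  have "group_elem g ^ k = group_elem (\<Sum>i<k. g)"
    by (induction k) (simp_all add: group_elem_0 group_elem_add)
  then show ?thesis by (simp add: int_multiple_of_nat)
qed

text \<open>A set is a sum of distinct group elements, and the \<open>p\<close>-th power of a group
  element is its multiple by \<open>p\<close>; additivity of \<open>p\<close>-th powers modulo
  \<open>p\<close> does the rest.\<close>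

lemma cong_lookup_set_elem_power:
  assumes "prime p"
  shows "[coeff (set_elem D ^ p) g = coeff (adams_power (set_elem D) (int p)) g] (mod int p)"
proof -
  have "of_nat p dvd set_elem D ^ p - adams_power (set_elem D) (int p)"
    using prime_dvd_power_sum_diff[OF assms, of group_elem D]
    by (simp add: adams_power_set_elem group_elem_power flip: set_elem_def)
  then obtain z where z: "set_elem D ^ p - adams_power (set_elem D) (int p) = of_nat p * z"
    by (elim dvdE)
  have "coeff (set_elem D ^ p) g - coeff (adams_power (set_elem D) (int p)) g = int p * coeff z g"
    using arg_cong[OF z, of "\<lambda>x. coeff x g"] by (simp add: lookup_minus)
  then show ?thesis by (simp add: cong_iff_dvd_diff)
qed


section \<open>Congruence profiles of coefficients\<close>

text \<open>Pure commutative algebra, with \<nu> standing for the integer \<open>n\<close>. Mixed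
  products are removed by \<open>A * B = H - 1\<close>, and products with \<open>H\<close> collapse
  to multiples of \<open>H\<close>.\<close>

lemma group_ring_identities:
  fixes A B H P Q \<nu> :: "'a::comm_ring_1"
  assumes AB: "A * B = H - 1"
    and sq: "A\<^sup>2 + B\<^sup>2 = 2 * H - P + 2 * \<nu>"
    and PP: "P\<^sup>2 = 4 * H + (2 * \<nu> - 2) - Q"
    and HA: "H * A = (\<nu> + 1) * H"
    and HB: "H * B = \<nu> * H"
    and HP: "H * P = (2 * \<nu> + 1) * H"
  shows "A * P = (\<nu> + 2) * H - A ^ 3 + 2 * \<nu> * A + B"
    and "B * P = (\<nu> - 1) * H - B ^ 3 + 2 * \<nu> * B + A"
    and "A * Q = (\<nu> ^ 3 + 4 * \<nu>\<^sup>2 + 9 * \<nu> + 5) * H - A ^ 5 + (4 * \<nu>\<^sup>2 + 2 * \<nu> - 3) * A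
           + 2 * \<nu> * B - 4 * \<nu> * (A * P) - B * P"
proof -
  have P: "P = 2 * H + 2 * \<nu> - A\<^sup>2 - B\<^sup>2" and Q: "Q = 4 * H + (2 * \<nu> - 2) - P\<^sup>2"
    using sq PP by (simp_all add: algebra_simps)
  have BAB: "B * (A * B) = H * B - B" and AAB: "A * (A * B) = H * A - A"
    by (simp_all add: AB algebra_simps)
  have "A * P = 2 * (H * A) + 2 * \<nu> * A - A ^ 3 - B * (A * B)"
    by (simp add: P algebra_simps power2_eq_square power3_eq_cube)
  then show AP: "A * P = (\<nu> + 2) * H - A ^ 3 + 2 * \<nu> * A + B"
    unfolding BAB HA HB by (simp add: algebra_simps)
  have "B * P = 2 * (H * B) + 2 * \<nu> * B - B ^ 3 - A * (A * B)"
    by (simp add: P algebra_simps power2_eq_square power3_eq_cube)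
  then show "B * P = (\<nu> - 1) * H - B ^ 3 + 2 * \<nu> * B + A"
    unfolding AAB HA HB by (simp add: algebra_simps)
  \<comment> \<open>The first identity is solved for \<open>A ^ 3\<close>, so that the identity for
    \<open>A * Q\<close> retains \<open>A ^ 5\<close> but no cube.\<close>
  have A3: "A ^ 3 = (\<nu> + 2) * H - A * P + 2 * \<nu> * A + B"
    using AP by (simp add: algebra_simps)
  have HAA: "H * A\<^sup>2 = (\<nu> + 1)\<^sup>2 * H"
  proof -
    have "H * A\<^sup>2 = (H * A) * A" by (simp add: power2_eq_square mult.assoc)
    also have "\<dots> = (\<nu> + 1) * (H * A)" by (subst HA) (simp only: mult_ac)
    finally show ?thesis unfolding HA by (simp add: power2_eq_square mult.assoc)
  qed
  have "A ^ 3 * P = A\<^sup>2 * (A * P)"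
    by (simp add: power2_eq_square power3_eq_cube mult_ac)
  also have "\<dots> = (\<nu> + 2) * (H * A\<^sup>2) - A ^ 5 + 2 * \<nu> * A ^ 3 + A * (A * B)"
    unfolding AP by (simp add: algebra_simps eval_nat_numeral)
  also have "\<dots> = (\<nu> + 2) * ((\<nu> + 1)\<^sup>2 * H) - A ^ 5
      + 2 * \<nu> * ((\<nu> + 2) * H - A * P + 2 * \<nu> * A + B) + ((\<nu> + 1) * H - A)"
    unfolding AAB HA HAA A3 ..
  finally have A3P: "A ^ 3 * P = (\<nu> + 2) * ((\<nu> + 1)\<^sup>2 * H) - A ^ 5
      + 2 * \<nu> * ((\<nu> + 2) * H - A * P + 2 * \<nu> * A + B) + ((\<nu> + 1) * H - A)" .
  have "A * Q = 4 * (H * A) + (2 * \<nu> - 2) * A - (A * P) * P"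
    by (simp add: Q algebra_simps power2_eq_square)
  also have "(A * P) * P = (\<nu> + 2) * (H * P) - A ^ 3 * P + 2 * \<nu> * (A * P) + B * P"
    by (subst AP) (simp add: algebra_simps)
  finally show "A * Q = (\<nu> ^ 3 + 4 * \<nu>\<^sup>2 + 9 * \<nu> + 5) * H - A ^ 5 + (4 * \<nu>\<^sup>2 + 2 * \<nu> - 3) * A
           + 2 * \<nu> * B - 4 * \<nu> * (A * P) - B * P"
    unfolding A3P HA HP by (simp add: algebra_simps power2_eq_square power3_eq_cube)
qed


text \<open>The right side of the identity for \<open>A * Q\<close> at one group element, where
  \<open>H\<close> has coefficient 1. The argument \<epsilon> is the coefficient of
  \<open>A ^ 5\<close> or, when working modulo 5, that of \<open>adams_power A 5\<close>.\<close>

definition residue :: "int \<Rightarrow> int \<Rightarrow> int \<Rightarrow> int \<Rightarrow> int \<Rightarrow> int \<Rightarrow> int" where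
  "residue \<nu> a b \<alpha> \<beta> \<epsilon> = (\<nu> ^ 3 + 4 * \<nu>\<^sup>2 + 9 * \<nu> + 5) - \<epsilon> + (4 * \<nu>\<^sup>2 + 2 * \<nu> - 3) * \<alpha>
     + 2 * \<nu> * \<beta> - 4 * \<nu> * a - b"

lemma residue_cong: "[\<nu> = \<nu>'] (mod m) \<Longrightarrow> [residue \<nu> a b \<alpha> \<beta> \<epsilon> = residue \<nu>' a b \<alpha> \<beta> \<epsilon>] (mod m)"
  unfolding residue_def by (intro cong_add cong_diff cong_mult cong_pow cong_refl)

text \<open>
  Here \<open>a\<close>, \<open>b\<close>, \<open>q\<close> stand for the coefficients of $AP$, $BP$, $AQ$ at one group element, and
  \<open>\<alpha>\<close>, \<open>\<beta>\<close>, \<open>\<gamma>\<close>, \<open>\<delta>\<close>, \<open>\<epsilon>\<close> for its membership in $T_0$, $T_1$, $T_0^{(3)}$, $T_1^{(3)}$, $T_0^{(5)}$.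
\<close>

definition profile :: "int \<Rightarrow> int \<Rightarrow> int \<Rightarrow> int \<Rightarrow> int \<Rightarrow> int \<Rightarrow> int \<Rightarrow> int \<Rightarrow> int \<Rightarrow> bool" where
  "profile \<nu> a b q \<alpha> \<beta> \<gamma> \<delta> \<epsilon> \<longleftrightarrow>
     0 \<le> a \<and> 0 \<le> b \<and> 0 \<le> q \<and> {\<alpha>, \<beta>, \<gamma>, \<delta>, \<epsilon>} \<subseteq> {0, 1} \<and> \<alpha> + \<beta> \<le> 1 \<and>
     [a = 1 - \<gamma> + \<alpha> + \<beta>] (mod 3) \<and> [b = 1 - \<delta> + \<alpha> + \<beta>] (mod 3) \<and>
     [q = residue \<nu> a b \<alpha> \<beta> \<epsilon>] (mod 5)"

lemma profileD:
  assumes "profile \<nu> a b q \<alpha> \<beta> \<gamma> \<delta> \<epsilon>"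
  shows "0 \<le> a" "0 \<le> b" "residue \<nu> a b \<alpha> \<beta> \<epsilon> mod 5 \<le> q" "0 \<le> q"
    "\<alpha> \<in> {0, 1}" "\<beta> \<in> {0, 1}" "\<gamma> \<in> {0, 1}" "\<delta> \<in> {0, 1}" "\<epsilon> \<in> {0, 1}" "\<alpha> + \<beta> \<le> 1"
    "(a - (1 - \<gamma> + \<alpha> + \<beta>)) mod 3 = 0" "(b - (1 - \<delta> + \<alpha> + \<beta>)) mod 3 = 0"
    "0 \<le> \<alpha>" "0 \<le> \<beta>" "0 \<le> \<gamma>" "0 \<le> \<delta>" "0 \<le> \<epsilon>"
proof -
  have "q mod 5 = residue \<nu> a b \<alpha> \<beta> \<epsilon> mod 5" and "0 \<le> q"
    using assms by (auto simp: profile_def cong_def)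
  \<comment> \<open>A nonnegative integer is at least its own remainder. The weighted bounds use the
    congruence modulo 5 only in this form.\<close>
  then show "residue \<nu> a b \<alpha> \<beta> \<epsilon> mod 5 \<le> q"
    using zmod_le_nonneg_dividend[of q 5] by simp
  show "(a - (1 - \<gamma> + \<alpha> + \<beta>)) mod 3 = 0" "(b - (1 - \<delta> + \<alpha> + \<beta>)) mod 3 = 0"
    using assms by (auto simp: profile_def cong_iff_dvd_diff dvd_imp_mod_0)
qed (use assms in \<open>auto simp: profile_def\<close>)

lemma profile_cong:
  assumes "[\<nu> = \<nu>'] (mod 5)" and "profile \<nu> a b q \<alpha> \<beta> \<gamma> \<delta> \<epsilon>"
  shows "profile \<nu>' a b q \<alpha> \<beta> \<gamma> \<delta> \<epsilon>"
proof -
  have "[q = residue \<nu>' a b \<alpha> \<beta> \<epsilon>] (mod 5)"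
  proof (rule cong_trans[OF _ residue_cong[OF assms(1)]])
    show "[q = residue \<nu> a b \<alpha> \<beta> \<epsilon>] (mod 5)"
      using assms(2) by (simp add: profile_def)
  qed
  then show ?thesis
    using assms(2) by (simp add: profile_def)
qed

text \<open>
  The weights in the following five bounds are dual solutions of the linear program that minimizes
  the sum of \<open>q\<close> subject to the known moments of \<open>a\<close> and \<open>b\<close>.
\<close>

lemma weighted_bound_0:
  assumes "profile 0 a b q \<alpha> \<beta> \<gamma> \<delta> \<epsilon>"
  shows "5 \<le> q + b + 3 * \<alpha> + 5 * \<delta> + \<epsilon>"
proof -
  note p = profileD[OF assms]
  \<comment> \<open>The remainder modulo 5 of this value, plus
    \<open>b + 3 * \<alpha> + \<epsilon>\<close>, is a nonnegative multiple of 5. If it is 0, then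
    \<open>b\<close> and \<alpha> vanish, and the congruence for \<open>b\<close> modulo 3 forces
    \<delta> = 1.\<close>
  have "residue 0 a b \<alpha> \<beta> \<epsilon> = 5 - \<epsilon> - 3 * \<alpha> - b" by (simp add: residue_def)
  with p show ?thesis by simp presburger
qed

lemma weighted_bound_1:
  assumes "profile 1 a b q \<alpha> \<beta> \<gamma> \<delta> \<epsilon>"
  shows "17 \<le> 3 * q + 2 * a + 3 * b + \<alpha> + 4 * \<beta> + 5 * \<gamma> + 15 * \<delta> + 3 * \<epsilon>"
proof -
  \<comment> \<open>Finite check with \<open>q\<close> replaced by its least value. Outside the box,
    \<open>2 * a\<close> or \<open>3 * b\<close> alone is at least 18.\<close>
  have small: "\<forall>\<alpha>\<in>set [0, 1]. \<forall>\<beta>\<in>set [0, 1]. \<alpha> + \<beta> \<le> 1 \<longrightarrow> (\<forall>\<gamma>\<in>set [0, 1].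
      \<forall>a\<in>set [0..8]. (a - (1 - \<gamma> + \<alpha> + \<beta>)) mod 3 = 0 \<longrightarrow> (\<forall>\<delta>\<in>set [0, 1].
      \<forall>b\<in>set [0..5]. (b - (1 - \<delta> + \<alpha> + \<beta>)) mod 3 = 0 \<longrightarrow> (\<forall>\<epsilon>\<in>set [0, 1].
      17 \<le> 3 * (residue 1 a b \<alpha> \<beta> \<epsilon> mod 5) + 2 * a + 3 * b + \<alpha> + 4 * \<beta> + 5 * \<gamma> + 15 * \<delta> + 3 * \<epsilon>)))"
    by code_simp
  note p = profileD[OF assms]
  show ?thesis
  proof (cases "a \<le> 8 \<and> b \<le> 5")
    case True
    then have "17 \<le> 3 * (residue 1 a b \<alpha> \<beta> \<epsilon> mod 5) + 2 * a + 3 * b + \<alpha> + 4 * \<beta> + 5 * \<gamma> + 15 * \<delta> + 3 * \<epsilon>"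
      using p by (intro small[rule_format]) auto
    then show ?thesis using p(3) by linarith
  next
    case False
    then have "a \<ge> 9 \<or> b \<ge> 6" by linarith
    then show ?thesis
    proof
      assume "a \<ge> 9"
      then show ?thesis using p(1,2,4,13-17) by linarith
    next
      assume "b \<ge> 6"
      then show ?thesis using p(1,2,4,13-17) by linarith
    qed
  qed
qed

lemma weighted_bound_2:
  assumes "profile 2 a b q \<alpha> \<beta> \<gamma> \<delta> \<epsilon>"
  shows "7 \<le> 3 * q - 6 * a + 3 * b + a\<^sup>2 + 6 * \<alpha> + 7 * \<gamma> + 15 * \<delta> + 3 * \<epsilon>"
proof -
  \<comment> \<open>Outside the box, either \<open>a \<ge> 8\<close> makes the quadratic in
    \<open>a\<close> at least 16, or \<open>b \<ge> 6\<close> contributes 18 against its minimum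
    -9.\<close>
  have small: "\<forall>\<alpha>\<in>set [0, 1]. \<forall>\<beta>\<in>set [0, 1]. \<alpha> + \<beta> \<le> 1 \<longrightarrow> (\<forall>\<gamma>\<in>set [0, 1].
      \<forall>a\<in>set [0..7]. (a - (1 - \<gamma> + \<alpha> + \<beta>)) mod 3 = 0 \<longrightarrow> (\<forall>\<delta>\<in>set [0, 1].
      \<forall>b\<in>set [0..5]. (b - (1 - \<delta> + \<alpha> + \<beta>)) mod 3 = 0 \<longrightarrow> (\<forall>\<epsilon>\<in>set [0, 1].
      7 \<le> 3 * (residue 2 a b \<alpha> \<beta> \<epsilon> mod 5) - 6 * a + 3 * b + a\<^sup>2 + 6 * \<alpha> + 7 * \<gamma> + 15 * \<delta> + 3 * \<epsilon>)))"
    by code_simp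
  note p = profileD[OF assms]
  show ?thesis
  proof (cases "a \<le> 7 \<and> b \<le> 5")
    case True
    then have "7 \<le> 3 * (residue 2 a b \<alpha> \<beta> \<epsilon> mod 5) - 6 * a + 3 * b + a\<^sup>2 + 6 * \<alpha> + 7 * \<gamma> + 15 * \<delta> + 3 * \<epsilon>"
      using p by (intro small[rule_format]) auto
    then show ?thesis using p(3) by linarith
  next
    case False
    then have "a \<ge> 8 \<or> b \<ge> 6" by linarith
    then show ?thesis
    proof
      assume "a \<ge> 8"
      then have "8 * a \<le> a\<^sup>2" by (simp add: power2_eq_square)
      with \<open>a \<ge> 8\<close> show ?thesis using p(1,2,4,13-17) by linarith
    next
      assume "b \<ge> 6"
      moreover have "0 \<le> (a - 3)\<^sup>2" by simp
      then have "6 * a - 9 \<le> a\<^sup>2" by (simp add: power2_eq_square algebra_simps)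
      ultimately show ?thesis using p(1,2,4,13-17) by linarith
    qed
  qed
qed

lemma weighted_bound_3:
  assumes "profile 3 a b q \<alpha> \<beta> \<gamma> \<delta> \<epsilon>"
  shows "1 \<le> 3 * q + a - 7 * b + b\<^sup>2 + 9 * \<alpha> + 9 * \<beta> + 10 * \<gamma> + 12 * \<delta> + 3 * \<epsilon>"
proof -
  \<comment> \<open>Outside the box, either \<open>a \<ge> 14\<close> outweighs the minimum -49/4 of
    the quadratic in \<open>b\<close>, or \<open>b \<ge> 8\<close> makes that quadratic at least
    8.\<close>
  have small: "\<forall>\<alpha>\<in>set [0, 1]. \<forall>\<beta>\<in>set [0, 1]. \<alpha> + \<beta> \<le> 1 \<longrightarrow> (\<forall>\<gamma>\<in>set [0, 1].
      \<forall>a\<in>set [0..13]. (a - (1 - \<gamma> + \<alpha> + \<beta>)) mod 3 = 0 \<longrightarrow> (\<forall>\<delta>\<in>set [0, 1].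
      \<forall>b\<in>set [0..7]. (b - (1 - \<delta> + \<alpha> + \<beta>)) mod 3 = 0 \<longrightarrow> (\<forall>\<epsilon>\<in>set [0, 1].
      1 \<le> 3 * (residue 3 a b \<alpha> \<beta> \<epsilon> mod 5) + a - 7 * b + b\<^sup>2 + 9 * \<alpha> + 9 * \<beta> + 10 * \<gamma> + 12 * \<delta> + 3 * \<epsilon>)))"
    by code_simp
  note p = profileD[OF assms]
  show ?thesis
  proof (cases "a \<le> 13 \<and> b \<le> 7")
    case True
    then have "1 \<le> 3 * (residue 3 a b \<alpha> \<beta> \<epsilon> mod 5) + a - 7 * b + b\<^sup>2 + 9 * \<alpha> + 9 * \<beta> + 10 * \<gamma> + 12 * \<delta> + 3 * \<epsilon>"
      using p by (intro small[rule_format]) auto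
    then show ?thesis using p(3) by linarith
  next
    case False
    then have "a \<ge> 14 \<or> b \<ge> 8" by linarith
    then show ?thesis
    proof
      assume "a \<ge> 14"
      moreover have "0 \<le> (2 * b - 7)\<^sup>2" by simp
      then have "28 * b - 49 \<le> 4 * b\<^sup>2" by (simp add: power2_eq_square algebra_simps)
      ultimately show ?thesis using p(1,2,4,13-17) by linarith
    next
      assume "b \<ge> 8"
      then have "8 * b \<le> b\<^sup>2" by (simp add: power2_eq_square)
      with \<open>b \<ge> 8\<close> show ?thesis using p(1,2,4,13-17) by linarith
    qed
  qed
qed

lemma weighted_bound_4:
  assumes "profile 4 a b q \<alpha> \<beta> \<gamma> \<delta> \<epsilon>"
  shows "0 \<le> 12 * q - 31 * a + 4 * a\<^sup>2 + 3 * (a * b) + 13 * \<alpha> + 25 * \<beta> + 48 * \<gamma> + 60 * \<delta> + 12 * \<epsilon>"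
proof -
  \<comment> \<open>Outside the box, \<open>31 * a\<close> is absorbed by the square term if
    \<open>a \<ge> 8\<close>, and by \<open>3 * (a * b) \<ge> 33 * a\<close> if
    \<open>b \<ge> 11\<close>.\<close>
  have small: "\<forall>\<alpha>\<in>set [0, 1]. \<forall>\<beta>\<in>set [0, 1]. \<alpha> + \<beta> \<le> 1 \<longrightarrow> (\<forall>\<gamma>\<in>set [0, 1].
      \<forall>a\<in>set [0..7]. (a - (1 - \<gamma> + \<alpha> + \<beta>)) mod 3 = 0 \<longrightarrow> (\<forall>\<delta>\<in>set [0, 1].
      \<forall>b\<in>set [0..10]. (b - (1 - \<delta> + \<alpha> + \<beta>)) mod 3 = 0 \<longrightarrow> (\<forall>\<epsilon>\<in>set [0, 1].
      0 \<le> 12 * (residue 4 a b \<alpha> \<beta> \<epsilon> mod 5) - 31 * a + 4 * a\<^sup>2 + 3 * (a * b) + 13 * \<alpha> + 25 * \<beta> + 48 * \<gamma> + 60 * \<delta> + 12 * \<epsilon>)))"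
    by code_simp
  note p = profileD[OF assms]
  show ?thesis
  proof (cases "a \<le> 7 \<and> b \<le> 10")
    case True
    then have "0 \<le> 12 * (residue 4 a b \<alpha> \<beta> \<epsilon> mod 5) - 31 * a + 4 * a\<^sup>2 + 3 * (a * b) + 13 * \<alpha> + 25 * \<beta> + 48 * \<gamma> + 60 * \<delta> + 12 * \<epsilon>"
      using p by (intro small[rule_format]) auto
    then show ?thesis using p(3) by linarith
  next
    case False
    then have "a \<ge> 8 \<or> b \<ge> 11" by linarith
    then show ?thesis
    proof
      assume "a \<ge> 8"
      then have "8 * a \<le> a\<^sup>2" "0 \<le> a * b" using p by (simp_all add: power2_eq_square)
      with \<open>a \<ge> 8\<close> show ?thesis using p(1,2,4,13-17) by linarith
    next
      assume "b \<ge> 11"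
      then have "a * 11 \<le> a * b" "0 \<le> a\<^sup>2" using p by (intro mult_left_mono, auto)
      then show ?thesis using p(1,2,4,13-17) by linarith
    qed
  qed
qed

section \<open>Symmetric elements, parity and coprimality\<close>

lemma coeff_adams_power_minus_1: "coeff (adams_power x (- 1)) g = coeff x (- g)"
proof -
  have "coeff (adams_power x (- 1)) g = (\<Sum>h\<in>{- g}. coeff x h * of_bool (- h = g))"
    unfolding adams_power_altdef lookup_sum lookup_of_int_mult lookup_group_elem int_multiple_minus_1
    by (rule sum.mono_neutral_right) auto
  then show ?thesis by simp
qed

lemma adams_power_minus_1_commute:
  "adams_power (adams_power x t) (- 1) = adams_power (adams_power x (- 1)) t"
proof -
  have "adams_power (adams_power x s) t = (\<Sum>g\<in>UNIV. of_int (coeff x g) * group_elem (int_multiple t (int_multiple s g)))"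
    for s t
    by (simp only: adams_power_altdef[of x s] adams_power_sum adams_power_of_int_mult adams_power_group_elem)
  then show ?thesis by (simp add: int_multiple_minus)
qed

text \<open>Turns intersection sizes and second moments into a single coefficient of a ring product,
  where the ring identities apply.\<close>

lemma coeff_mult_0_symmetric:
  assumes "adams_power y (- 1) = y"
  shows "coeff (x * y) 0 = (\<Sum>g\<in>UNIV. coeff x g * coeff y g)"
proof -
  have "coeff y (- g) = coeff y g" for g
    using coeff_adams_power_minus_1[of y g] assms by simp
  then show ?thesis by (simp add: lookup_mult_convolution)
qed

text \<open>The coefficient of the square of \<open>T\<close> at 0 counts \<open>T\<close>, and
  modulo 2 it agrees with that of \<open>adams_power (set_elem T) 2\<close>, which is 1. This later
  decides which of the two sets has \<open>n + 1\<close> elements.\<close>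

lemma odd_card_inverse_closed:
  assumes inj: "inj (int_multiple 2 :: 'h \<Rightarrow> 'h)"
    and "inverse_closed T" and zero: "0 \<in> (T :: 'h::{finite, ab_group_add} set)"
  shows "odd (card T)"
proof -
  have "coeff ((set_elem T)\<^sup>2) 0 = int (card T)"
    unfolding power2_eq_square using assms(2)
    by (subst coeff_mult_0_symmetric)
       (simp_all add: inverse_closed_def lookup_set_elem flip: of_bool_conj)
  moreover have "0 \<in> int_multiple 2 ` T"
    using zero int_multiple_0 by (metis image_eqI)
  then have "coeff (adams_power (set_elem T) 2) 0 = 1"
    by (simp add: adams_power_set_elem_inj[OF inj] lookup_set_elem)
  ultimately have "[int (card T) = 1] (mod 2)"
    using cong_lookup_set_elem_power[OF two_is_prime_nat, of T 0] by simp
  then show ?thesis by (simp add: cong_def) presburger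
qed

text \<open>Makes multiplication by 2, 3 and 5 injective on the group. The polynomial takes the
  value 7 at 2, hence 1 modulo 3, and has no root modulo 5.\<close>

lemma coprime_card:
  fixes n :: nat
  assumes "even n" "n mod 3 = 2"
  shows "coprime 2 (n\<^sup>2 + n + 1)" "coprime 3 (n\<^sup>2 + n + 1)" "coprime 5 (n\<^sup>2 + n + 1)"
proof -
  have mod: "(n\<^sup>2 + n + 1) mod m = ((n mod m)\<^sup>2 + n mod m + 1) mod m" for m
    unfolding cong_def[symmetric]
    by (intro cong_add cong_pow cong_refl) (simp_all add: cong_def)
  show "coprime 2 (n\<^sup>2 + n + 1)" using assms by simp
  have "\<not> 3 dvd n\<^sup>2 + n + 1"
    unfolding dvd_eq_mod_eq_0 mod[of 3] assms(2) by simp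
  then show "coprime 3 (n\<^sup>2 + n + 1)" by (intro prime_imp_coprime) auto
  have "n mod 5 < 5" by simp
  then have "n mod 5 = 0 \<or> n mod 5 = 1 \<or> n mod 5 = 2 \<or> n mod 5 = 3 \<or> n mod 5 = 4" by linarith
  then have "\<not> 5 dvd n\<^sup>2 + n + 1"
    unfolding dvd_eq_mod_eq_0 mod[of 5] by (elim disjE) simp_all
  then show "coprime 5 (n\<^sup>2 + n + 1)" by (intro prime_imp_coprime) auto
qed

section \<open>Moments of the coefficients\<close>

locale factorization_pair =
  fixes n :: nat and T0 T1 :: "'h::{finite, ab_group_add} set"
  assumes even: "even n" and mod3: "n mod 3 = 2"
    and card_group: "CARD('h) = n\<^sup>2 + n + 1"
    and inverse_closed: "inverse_closed T0" "inverse_closed T1"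
    and zero: "0 \<in> T0"
    and mult: "set_elem T0 * set_elem T1 = set_elem UNIV - group_elem 0"
    and squares: "(set_elem T0)\<^sup>2 + (set_elem T1)\<^sup>2 =
             2 * set_elem UNIV - adams_power (set_elem T0) 2 - adams_power (set_elem T1) 2
               + 2 * of_nat n * group_elem 0"
begin

abbreviation A where "A \<equiv> set_elem T0"
abbreviation B where "B \<equiv> set_elem T1"
abbreviation H :: "'h group_ring" where "H \<equiv> set_elem UNIV"
definition P where "P = adams_power (A + B) 2"
definition Q where "Q = adams_power P 2"

lemma inj_multiple:
  "inj (int_multiple 2 :: 'h \<Rightarrow> 'h)" "inj (int_multiple 3 :: 'h \<Rightarrow> 'h)" "inj (int_multiple 5 :: 'h \<Rightarrow> 'h)"
  using inj_int_multiple[of 2, where 'h='h] inj_int_multiple[of 3, where 'h='h] inj_int_multiple[of 5, where 'h='h]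
    coprime_card[OF even mod3] by (simp_all add: card_group)

text \<open>The augmentations of the two equations determine the product and the sum of the
  cardinalities; parity then tells the two sets apart.\<close>

lemma cards: "card T0 = n + 1" "card T1 = n"
proof -
  have prod: "card T0 * card T1 = n\<^sup>2 + n"
  proof -
    have "int (card T0) * int (card T1) = int (n\<^sup>2 + n)"
      using arg_cong[OF mult, of augmentation]
      by (simp add: augmentation_mult augmentation_diff augmentation_set_elem augmentation_group_elem card_group)
    then show ?thesis by (simp only: flip: of_nat_mult of_nat_eq_iff)
  qed
  have eq: "(card T0)\<^sup>2 + (card T1)\<^sup>2 + card T0 + card T1 = 2 * (n\<^sup>2 + n + 1) + 2 * n"
  proof -
    have "set_elem T0 * set_elem T0 + set_elem T1 * set_elem T1 =
        of_int 2 * H - adams_power A 2 - adams_power B 2 + of_int (2 * int n) * group_elem 0"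
      using squares by (simp add: power2_eq_square)
    from arg_cong[OF this, of augmentation]
    have "int (card T0) * int (card T0) + int (card T1) * int (card T1)
        = 2 * int (n\<^sup>2 + n + 1) - int (card T0) - int (card T1) + 2 * int n"
      unfolding augmentation_diff augmentation_add augmentation_of_int_mult
      unfolding augmentation_mult augmentation_set_elem augmentation_group_elem
        augmentation_adams_power card_group by simp
    then have "int ((card T0)\<^sup>2 + (card T1)\<^sup>2 + card T0 + card T1) = int (2 * (n\<^sup>2 + n + 1) + 2 * n)"
      by (simp add: power2_eq_square)
    then show ?thesis by (simp only: of_nat_eq_iff)
  qed
  have sum: "card T0 + card T1 = 2 * n + 1"
  proof -
    let ?s = "card T0 + card T1"
    \<comment> \<open>Adding twice \<open>prod\<close> to \<open>eq\<close> completes the square.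
      The map from \<open>s\<close> to \<open>s * (s + 1)\<close> is strictly increasing, so
      \<open>s\<close> is determined.\<close>
    have "?s * (?s + 1) = (2 * n + 1) * (2 * n + 2)"
      using prod eq by (simp add: power2_eq_square algebra_simps)
    moreover have "?s * (?s + 1) < (2 * n + 1) * (2 * n + 2)" if "?s < 2 * n + 1"
      using that by (intro mult_strict_mono) auto
    moreover have "?s * (?s + 1) > (2 * n + 1) * (2 * n + 2)" if "?s > 2 * n + 1"
      using that by (intro mult_strict_mono) auto
    ultimately show ?thesis by (metis nat_neq_iff)
  qed
  have "(int (card T0) - int n) * (int (card T0) - int (n + 1)) = 0"
  proof -
    have "int (card T1) = 2 * int n + 1 - int (card T0)" using sum by simp
    then have "int (card T0) * (2 * int n + 1 - int (card T0)) = int n * int n + int n"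
      using prod by (metis of_nat_add of_nat_mult power2_eq_square)
    then show ?thesis by (simp add: algebra_simps)
  qed
  then have "card T0 = n \<or> card T0 = n + 1" by auto
  \<comment> \<open>Of the two roots \<open>n\<close> and \<open>n + 1\<close> only the second is
    odd.\<close>
  moreover have "odd (card T0)"
    using odd_card_inverse_closed inj_multiple(1) inverse_closed(1) zero by blast
  ultimately show "card T0 = n + 1" using even by auto
  with sum show "card T1 = n" by simp
qed

text \<open>Since \<open>T1\<close> is inverse-closed, the coefficient of \<open>A * B\<close> at 0
  counts common elements, and \<open>H - 1\<close> vanishes there.\<close>

lemma disjoint: "T0 \<inter> T1 = {}"
proof -
  have "int (card (T0 \<inter> T1)) = coeff (A * B) 0"
    using inverse_closed(2)
    by (subst coeff_mult_0_symmetric)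
       (simp_all add: inverse_closed_def lookup_set_elem Int_def flip: of_bool_conj)
  also have "\<dots> = 0"
    by (simp add: mult lookup_minus lookup_set_elem lookup_group_elem)
  finally show ?thesis by simp
qed

lemma square_sum: "A\<^sup>2 + B\<^sup>2 = 2 * H - P + 2 * of_nat n"
  using squares by (simp add: P_def adams_power_add group_elem_0)

text \<open>The two equations combine to an expression for the square of \<open>A + B\<close> that
  is linear in \<open>H\<close>, 1 and \<open>P\<close>. Applying the ring endomorphism
  \<open>adams_power _ 2\<close> sends \<open>A + B\<close> to \<open>P\<close> and \<open>P\<close>
  to \<open>Q\<close>, and fixes \<open>H\<close> because doubling is bijective.\<close>

lemma P_square: "P\<^sup>2 = 4 * H + (2 * of_nat n - 2) - Q"
proof -
  have "(A + B)\<^sup>2 = (A\<^sup>2 + B\<^sup>2) + 2 * (A * B)"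
    by (simp add: power2_eq_square algebra_simps)
  also have "\<dots> = of_int 4 * H + of_int (2 * int n - 2) * group_elem 0 - P"
    unfolding square_sum mult by (simp add: group_elem_0)
  finally have "adams_power ((A + B)\<^sup>2) 2
      = adams_power (of_int 4 * H + of_int (2 * int n - 2) * group_elem 0 - P) 2"
    by (rule arg_cong)
  moreover have "adams_power H 2 = H"
    using inj_multiple(1) by (simp add: adams_power_set_elem_inj finite_UNIV_inj_surj)
  ultimately show ?thesis
    unfolding adams_power_add adams_power_diff adams_power_of_int_mult adams_power_group_elem
    by (simp add: power2_eq_square adams_power_mult Q_def group_elem_0 flip: P_def)
qed

lemma augmentations:
  "augmentation A = int n + 1" "augmentation B = int n"
  "augmentation P = 2 * int n + 1" "augmentation Q = 2 * int n + 1"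
  by (simp_all add: P_def Q_def augmentation_adams_power augmentation_add augmentation_set_elem cards)

lemmas identities = group_ring_identities[OF mult[unfolded group_elem_0] square_sum P_square]

lemma nonneg: "0 \<le> coeff A g" "0 \<le> coeff B g" "0 \<le> coeff P g" "0 \<le> coeff Q g"
proof -
  show *: "0 \<le> coeff A g" "0 \<le> coeff B g" for g by (simp_all add: lookup_set_elem)
  show P: "0 \<le> coeff P g" for g
    unfolding P_def by (rule lookup_adams_power_nonneg) (simp add: lookup_add *)
  show "0 \<le> coeff Q g"
    unfolding Q_def by (rule lookup_adams_power_nonneg) (rule P)
qed

lemma symmetric:
  "adams_power A (- 1) = A" "adams_power B (- 1) = B" "adams_power P (- 1) = P"
proof -
  show *: "adams_power A (- 1) = A" "adams_power B (- 1) = B"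
    using inverse_closed by (simp_all add: inverse_closed_def)
  show "adams_power P (- 1) = P"
    by (simp add: P_def adams_power_minus_1_commute adams_power_add *)
qed

text \<open>By symmetry the sum is the coefficient at 0 of \<open>(?X * ?X) * P^2\<close>. After
  \<open>P_square\<close> every term is explicit except the one with \<open>Q\<close>, which has a
  favourable sign and is dropped.\<close>

lemma second_moment:
  assumes "inverse_closed D"
  shows "(\<Sum>g\<in>UNIV. (coeff (set_elem D * P) g)\<^sup>2)
           \<le> 4 * (int (card D))\<^sup>2 + (2 * int n - 2) * int (card D)"
proof -
  let ?X = "set_elem D"
  have sym: "adams_power ?X (- 1) = ?X"
    using assms by (simp add: inverse_closed_def)
  have "(\<Sum>g\<in>UNIV. (coeff (?X * P) g)\<^sup>2) = coeff ((?X * P) * (?X * P)) 0"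
    by (subst coeff_mult_0_symmetric) (simp_all add: adams_power_mult sym symmetric power2_eq_square)
  also have "(?X * P) * (?X * P) = (?X * ?X) * P\<^sup>2"
    by (simp add: power2_eq_square mult_ac)
  also have "\<dots> = of_int 4 * (H * (?X * ?X)) + of_int (2 * int n - 2) * (?X * ?X) - ?X * ?X * Q"
    unfolding P_square by (simp add: algebra_simps)
  also have "coeff \<dots> 0 = 4 * (int (card D))\<^sup>2 + (2 * int n - 2) * coeff (?X * ?X) 0 - coeff (?X * ?X * Q) 0"
    unfolding set_elem_UNIV_mult lookup_add lookup_minus lookup_of_int_mult
    by (simp add: augmentation_mult augmentation_set_elem lookup_set_elem power2_eq_square)
  also have "coeff (?X * ?X) 0 = int (card D)"
    using sym by (subst coeff_mult_0_symmetric) (simp_all add: lookup_set_elem flip: of_bool_conj)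
  finally have "(\<Sum>g\<in>UNIV. (coeff (?X * P) g)\<^sup>2)
      = 4 * (int (card D))\<^sup>2 + (2 * int n - 2) * int (card D) - coeff (?X * ?X * Q) 0" .
  moreover have "0 \<le> coeff (?X * ?X * Q) 0"
    unfolding lookup_mult_convolution
    by (intro sum_nonneg mult_nonneg_nonneg nonneg) (simp_all add: lookup_set_elem)
  ultimately show ?thesis by simp
qed

text \<open>The product regroups as \<open>(A * B) * (P * P)\<close> with
  \<open>A * B = H - 1\<close>; the nonnegative coefficient of \<open>P * P\<close> at 0 is
  dropped.\<close>

lemma mixed_moment: "(\<Sum>g\<in>UNIV. coeff (A * P) g * coeff (B * P) g) \<le> (2 * int n + 1)\<^sup>2"
proof -
  have "(\<Sum>g\<in>UNIV. coeff (A * P) g * coeff (B * P) g) = coeff ((A * P) * (B * P)) 0"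
    by (subst coeff_mult_0_symmetric) (simp_all add: adams_power_mult symmetric)
  also have "(A * P) * (B * P) = (A * B) * (P * P)"
    by (simp add: mult_ac)
  also have "\<dots> = H * (P * P) - P * P"
    unfolding mult by (simp add: group_elem_0 left_diff_distrib)
  also have "coeff \<dots> 0 = (2 * int n + 1)\<^sup>2 - coeff (P * P) 0"
    unfolding set_elem_UNIV_mult lookup_minus lookup_of_int_mult
    by (simp add: augmentation_mult augmentations lookup_set_elem power2_eq_square)
  finally have "(\<Sum>g\<in>UNIV. coeff (A * P) g * coeff (B * P) g) = (2 * int n + 1)\<^sup>2 - coeff (P * P) 0" .
  moreover have "0 \<le> coeff (P * P) 0"
    unfolding lookup_mult_convolution by (intro sum_nonneg mult_nonneg_nonneg nonneg)
  ultimately show ?thesis by simp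
qed

lemma coeff_adams_power_set_elem:
  fixes D :: "'h set"
  shows
  "coeff (adams_power (set_elem D) 3) g = of_bool (g \<in> int_multiple 3 ` D)"
  "coeff (adams_power (set_elem D) 5) g = of_bool (g \<in> int_multiple 5 ` D)"
  using inj_multiple by (simp_all add: adams_power_set_elem_inj lookup_set_elem)

text \<open>The three ring identities are read at \<open>g\<close>, and then \<open>A ^ 3\<close>,
  \<open>B ^ 3\<close>, \<open>A ^ 5\<close> are replaced by power operations modulo 3 and 5. These
  have 0/1 coefficients because multiplication by 3 and 5 is injective.\<close>

lemma coeff_profile:
  "profile (int n) (coeff (A * P) g) (coeff (B * P) g) (coeff (A * Q) g) (coeff A g) (coeff B g)
     (coeff (adams_power A 3) g) (coeff (adams_power B 3) g) (coeff (adams_power A 5) g)"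
proof -
  have HX: "H * A = (of_nat n + 1) * H" "H * B = of_nat n * H" "H * P = (2 * of_nat n + 1) * H"
    by (simp_all add: set_elem_UNIV_mult augmentations)
  note ids = identities[OF HX]
  have H: "coeff H g = 1" by (simp add: lookup_set_elem)
  have a: "coeff (A * P) g = (int n + 2) - coeff (A ^ 3) g + 2 * int n * coeff A g + coeff B g"
  proof -
    have "A * P = of_int (int n + 2) * H - A ^ 3 + of_int (2 * int n) * A + B"
      by (subst ids(1)) simp
    then show ?thesis
      by (simp only: lookup_add lookup_minus lookup_of_int_mult H mult_1_right)
  qed
  have b: "coeff (B * P) g = (int n - 1) - coeff (B ^ 3) g + 2 * int n * coeff B g + coeff A g"
  proof -
    have "B * P = of_int (int n - 1) * H - B ^ 3 + of_int (2 * int n) * B + A"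
      by (subst ids(2)) simp
    then show ?thesis
      by (simp only: lookup_add lookup_minus lookup_of_int_mult H mult_1_right)
  qed
  have q: "coeff (A * Q) g = residue (int n) (coeff (A * P) g) (coeff (B * P) g)
      (coeff A g) (coeff B g) (coeff (A ^ 5) g)"
  proof -
    have "A * Q = of_int (int n ^ 3 + 4 * (int n)\<^sup>2 + 9 * int n + 5) * H - A ^ 5
        + of_int (4 * (int n)\<^sup>2 + 2 * int n - 3) * A + of_int (2 * int n) * B
        - of_int (4 * int n) * (A * P) - B * P"
      by (subst ids(3)) simp
    then show ?thesis unfolding residue_def
      by (simp only: lookup_add lookup_minus lookup_of_int_mult H mult_1_right)
  qed
  \<comment> \<open>With \<open>n\<close> congruent to 2 modulo 3, the numbers \<open>n + 2\<close>,
    \<open>n - 1\<close> and \<open>2 * n\<close> are all congruent to 1, so both congruences take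
    the same shape.\<close>
  have red: "[x = 2 + 2 - c + 2 * 2 * \<alpha> + \<beta>] (mod 3) \<Longrightarrow> [x = 1 - c + \<alpha> + \<beta>] (mod 3)"
    "[x = 2 - 1 - c + 2 * 2 * \<beta> + \<alpha>] (mod 3) \<Longrightarrow> [x = 1 - c + \<alpha> + \<beta>] (mod 3)"
    for x c \<alpha> \<beta> :: int
    unfolding cong_iff_dvd_diff by presburger+
  have "int (n mod 3) = 2" using mod3 by simp
  then have n3: "[int n = 2] (mod 3)"
    by (simp add: cong_def zmod_int)
  have c3: "[coeff (set_elem D ^ 3) g = coeff (adams_power (set_elem D) 3) g] (mod 3)" for D
    using cong_lookup_set_elem_power[of 3 D g] by simp
  have c5: "[coeff (A ^ 5) g = coeff (adams_power A 5) g] (mod 5)"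
    using cong_lookup_set_elem_power[of 5 T0 g] by simp
  have "[coeff (A * P) g = (2 + 2) - coeff (adams_power A 3) g + 2 * 2 * coeff A g + coeff B g] (mod 3)"
    unfolding a by (intro cong_add cong_diff cong_mult cong_refl n3 c3)
  then have "[coeff (A * P) g = 1 - coeff (adams_power A 3) g + coeff A g + coeff B g] (mod 3)"
    by (rule red)
  moreover have "[coeff (B * P) g = (2 - 1) - coeff (adams_power B 3) g + 2 * 2 * coeff B g + coeff A g] (mod 3)"
    unfolding b by (intro cong_add cong_diff cong_mult cong_refl n3 c3)
  then have "[coeff (B * P) g = 1 - coeff (adams_power B 3) g + coeff A g + coeff B g] (mod 3)"
    by (rule red)
  moreover have "[coeff (A * Q) g = residue (int n) (coeff (A * P) g) (coeff (B * P) g)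
      (coeff A g) (coeff B g) (coeff (adams_power A 5) g)] (mod 5)"
    unfolding q residue_def by (intro cong_add cong_diff cong_mult cong_refl c5)
  moreover have "0 \<le> coeff (A * P) g" "0 \<le> coeff (B * P) g" "0 \<le> coeff (A * Q) g"
    unfolding lookup_mult_convolution by (intro sum_nonneg mult_nonneg_nonneg nonneg)+
  moreover have "coeff A g + coeff B g \<le> 1"
    using disjoint by (auto simp: lookup_set_elem)
  moreover have "{coeff A g, coeff B g, coeff (adams_power A 3) g, coeff (adams_power B 3) g,
      coeff (adams_power A 5) g} \<subseteq> {0, 1}"
    by (simp add: lookup_set_elem coeff_adams_power_set_elem)
  ultimately show ?thesis unfolding profile_def by (intro conjI)
qed

text \<open>Weak duality: a pointwise bound on profiles is summed over the group. First moments are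
  known exactly, whereas the quadratic ones are only bounded above, hence the sign conditions on
  \<open>c3\<close>, \<open>c4\<close>, \<open>c5\<close>.\<close>

lemma weighted_count:
  fixes \<mu> w c1 c2 c3 c4 c5 lA lB lA3 lB3 lA5 :: int
  assumes bound: "\<And>a b q \<alpha> \<beta> \<gamma> \<delta> \<epsilon>. profile r a b q \<alpha> \<beta> \<gamma> \<delta> \<epsilon> \<Longrightarrow>
      \<mu> \<le> w * q + c1 * a + c2 * b + c3 * a\<^sup>2 + c4 * b\<^sup>2 + c5 * (a * b)
           + lA * \<alpha> + lB * \<beta> + lA3 * \<gamma> + lB3 * \<delta> + lA5 * \<epsilon>"
    and r: "[int n = r] (mod 5)" and nonneg: "0 \<le> c3" "0 \<le> c4" "0 \<le> c5"
  defines "m \<equiv> int n"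
  shows "\<mu> * (m\<^sup>2 + m + 1) \<le> w * ((m + 1) * (2 * m + 1)) + c1 * ((m + 1) * (2 * m + 1))
      + c2 * (m * (2 * m + 1)) + c3 * (4 * (m + 1)\<^sup>2 + (2 * m - 2) * (m + 1))
      + c4 * (4 * m\<^sup>2 + (2 * m - 2) * m) + c5 * (2 * m + 1)\<^sup>2
      + lA * (m + 1) + lB * m + lA3 * (m + 1) + lB3 * m + lA5 * (m + 1)"
proof -
  let ?a = "coeff (A * P)" and ?b = "coeff (B * P)" and ?q = "coeff (A * Q)"
  have prof: "profile r (?a g) (?b g) (?q g) (coeff A g) (coeff B g) (coeff (adams_power A 3) g)
      (coeff (adams_power B 3) g) (coeff (adams_power A 5) g)" for g
    by (rule profile_cong[OF r coeff_profile])
  have aug: "(\<Sum>g\<in>UNIV. coeff x g) = augmentation x" for x :: "'h group_ring"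
    by (simp add: augmentation_def)
  have m1: "int (card T0) = m + 1" and m0: "int (card T1) = m"
    by (simp_all add: cards m_def)
  have moments: "c3 * (\<Sum>g\<in>UNIV. (?a g)\<^sup>2) \<le> c3 * (4 * (m + 1)\<^sup>2 + (2 * m - 2) * (m + 1))"
    "c4 * (\<Sum>g\<in>UNIV. (?b g)\<^sup>2) \<le> c4 * (4 * m\<^sup>2 + (2 * m - 2) * m)"
    "c5 * (\<Sum>g\<in>UNIV. ?a g * ?b g) \<le> c5 * (2 * m + 1)\<^sup>2"
    using second_moment[OF inverse_closed(1), unfolded m1] second_moment[OF inverse_closed(2), unfolded m0]
      mixed_moment nonneg unfolding m_def by (blast intro: mult_left_mono)+
  have "\<mu> * (m\<^sup>2 + m + 1) = (\<Sum>g\<in>(UNIV :: 'h set). \<mu>)"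
    by (simp add: card_group m_def algebra_simps)
  also have "\<dots> \<le> (\<Sum>g\<in>UNIV. w * ?q g + c1 * ?a g + c2 * ?b g + c3 * (?a g)\<^sup>2 + c4 * (?b g)\<^sup>2
      + c5 * (?a g * ?b g) + lA * coeff A g + lB * coeff B g + lA3 * coeff (adams_power A 3) g
      + lB3 * coeff (adams_power B 3) g + lA5 * coeff (adams_power A 5) g)"
    by (intro sum_mono bound prof)
  also have "\<dots> = w * ((m + 1) * (2 * m + 1)) + c1 * ((m + 1) * (2 * m + 1)) + c2 * (m * (2 * m + 1))
      + c3 * (\<Sum>g\<in>UNIV. (?a g)\<^sup>2) + c4 * (\<Sum>g\<in>UNIV. (?b g)\<^sup>2) + c5 * (\<Sum>g\<in>UNIV. ?a g * ?b g)
      + lA * (m + 1) + lB * m + lA3 * (m + 1) + lB3 * m + lA5 * (m + 1)"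
    by (simp only: sum.distrib flip: sum_distrib_left)
       (simp only: aug augmentation_mult augmentation_adams_power augmentations m_def)
  also have "\<dots> \<le> w * ((m + 1) * (2 * m + 1)) + c1 * ((m + 1) * (2 * m + 1))
      + c2 * (m * (2 * m + 1)) + c3 * (4 * (m + 1)\<^sup>2 + (2 * m - 2) * (m + 1))
      + c4 * (4 * m\<^sup>2 + (2 * m - 2) * m) + c5 * (2 * m + 1)\<^sup>2
      + lA * (m + 1) + lB * m + lA3 * (m + 1) + lB3 * m + lA5 * (m + 1)"
    by (intro add_mono order_refl moments)
  finally show ?thesis .
qed

end

section \<open>Contradiction in each residue class modulo 5\<close>

theorem theorem6p7:
  fixes n :: nat
  assumes "n > 0" and "even n" and "n mod 3 = 2"
    and "(n \<ge> 20 \<and> n mod 5 = 0) \<or>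
         (n \<ge> 206 \<and> n mod 5 = 1) \<or>
         (n \<ge> 115 \<and> n mod 5 = 2) \<or>
         (n \<ge> 163 \<and> n mod 5 = 3) \<or>
         (n \<ge> 235 \<and> n mod 5 = 4)"
    and "CARD('h::{finite, ab_group_add}) = n\<^sup>2 + n + 1"
  shows "\<not> (\<exists>T0 T1 :: 'h set.
           inverse_closed T0 \<and> inverse_closed T1 \<and> 0 \<in> T0 \<and>
           set_elem T0 * set_elem T1 = set_elem UNIV - group_elem 0 \<and>
           (set_elem T0)\<^sup>2 + (set_elem T1)\<^sup>2 =
             2 * set_elem UNIV - adams_power (set_elem T0) 2 - adams_power (set_elem T1) 2
               + 2 * of_nat n * group_elem 0)"
proof (rule notI, elim exE conjE)
  fix T0 T1 :: "'h set"
  assume "inverse_closed T0" "inverse_closed T1" "0 \<in> T0"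
    "set_elem T0 * set_elem T1 = set_elem UNIV - group_elem 0"
    "(set_elem T0)\<^sup>2 + (set_elem T1)\<^sup>2 =
       2 * set_elem UNIV - adams_power (set_elem T0) 2 - adams_power (set_elem T1) 2
         + 2 * of_nat n * group_elem 0"
  then interpret factorization_pair n T0 T1
    using assms by unfold_locales
  have n5: "[int n = r] (mod 5)" if "n mod 5 = nat r" "0 \<le> r" for r
    using that by (metis cong_mod_left cong_refl nat_0_le of_nat_numeral zmod_int)
  consider "n \<ge> 20" "n mod 5 = 0" | "n \<ge> 206" "n mod 5 = 1" | "n \<ge> 115" "n mod 5 = 2"
    | "n \<ge> 163" "n mod 5 = 3" | "n \<ge> 235" "n mod 5 = 4"
    using assms(4) by auto
  \<comment> \<open>The numbers given to \<open>weighted_count\<close> are, in order,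
    \<open>r\<close>, \<mu>, \<open>w\<close>, \<open>c1\<close> to \<open>c5\<close> and the five
    membership weights. In the five cases the coefficient of \<open>n^2\<close> on the left exceeds
    that on the right by 1, 1, 1, 1 and 2, so \<open>n^2\<close> is bounded by a linear expression
    in \<open>n\<close>, which the lower bound on \<open>n\<close> contradicts.\<close>
  then show False
  proof cases
    case 1
    have "(int n)\<^sup>2 \<le> 8 * int n"
      using weighted_count[of 0 5 1 0 1 0 0 0 3 0 0 5 1, OF _ n5] weighted_bound_0 1(2)
      by (simp add: algebra_simps power2_eq_square)
    moreover have "20 * int n \<le> (int n)\<^sup>2"
      using 1(1) by (simp add: power2_eq_square)
    ultimately show False
      using 1(1) by linarith
  next
    case 2
    have "(int n)\<^sup>2 + 3 \<le> 29 * int n"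
      using weighted_count[of 1 17 3 2 3 0 0 0 1 4 5 15 3, OF _ n5] weighted_bound_1 2(2)
      by (simp add: algebra_simps power2_eq_square)
    moreover have "206 * int n \<le> (int n)\<^sup>2"
      using 2(1) by (simp add: power2_eq_square)
    ultimately show False
      using 2(1) by linarith
  next
    case 3
    have "(int n)\<^sup>2 \<le> 26 * int n + 8"
      using weighted_count[of 2 7 3 "- 6" 3 1 0 0 6 0 7 15 3, OF _ n5] weighted_bound_2 3(2)
      by (simp add: algebra_simps power2_eq_square)
    moreover have "115 * int n \<le> (int n)\<^sup>2"
      using 3(1) by (simp add: power2_eq_square)
    ultimately show False
      using 3(1) by linarith
  next
    case 4
    have "(int n)\<^sup>2 \<le> 45 * int n + 25"
      using weighted_count[of 3 1 3 1 "- 7" 0 1 0 9 9 10 12 3, OF _ n5] weighted_bound_3 4(2)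
      by (simp add: algebra_simps power2_eq_square)
    moreover have "163 * int n \<le> (int n)\<^sup>2"
      using 4(1) by (simp add: power2_eq_square)
    ultimately show False
      using 4(1) by linarith
  next
    case 5
    have "2 * (int n)\<^sup>2 \<le> 145 * int n + 65"
      using weighted_count[of 4 0 12 "- 31" 0 4 0 3 13 25 48 60 12, OF _ n5] weighted_bound_4 5(2)
      by (simp add: algebra_simps power2_eq_square)
    moreover have "235 * int n \<le> (int n)\<^sup>2"
      using 5(1) by (simp add: power2_eq_square)
    ultimately show False
      using 5(1) by linarith
  qed
qed

end
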